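(* Assume that the costs $c_i$ are non-increasing in $i$, and assume the regularity conditions (A) and (B) listed in the context. The solution to the control problem described in the context can be $\rho_1=1$ only in the case $$j_1\le j_2\frac{\rho_2}{1-\rho_2}.$$ Specifically, the equality is achieved only for $c_i\equiv c$, $i=1,2,\dots,L$, where $c$ is an arbitrary positive constant.
   Context: Model. Let $\lambda>0$, let $(r_i)_{i\ge1}$ be a probability distribution on the positive integers, and let $\varsigma$ be a random variable with $\Pr\{\varsigma=i\}=r_i$ and $\mathsf E\varsigma<\infty$; put $\widehat R(z)=\sum_{i\ge1}r_iz^i$. Let $B_1,B_2$ be distribution functions of nonnegative random variables with positive finite means $1/\mu_1,1/\mu_2$; put $\rho_k=\lambda\mathsf E\varsigma/\mu_k$ ($k=1,2$), $\rho_{1,l}=\lambda^l\int_0^\infty x^l\,dB_1(x)$, and let $\widehat B_1$ be the Laplace--Stieltjes transform of $B_1$. Assume $\rho_2<1$. For an integer $L\ge1$ consider the single-server queue in which batches arrive at the epochs of a Poisson process of rate $\lambda$ with i.i.d. batch sizes distributed as $\varsigma$, customers are served one at a time with independent service times, and a service has distribution $B_2$ if the queue-length (number in system) immediately before its beginning exceeds $L$, and distribution $B_1$ otherwise (the service opening a busy period starts from an empty system, hence has distribution $B_1$). Let $L_t$ be the number of customers in the system at time $t$. Then $p_1=\lim_{t\to\infty}\Pr\{L_t=0\}$, $p_2$ is the limiting probability as $t\to\infty$ that a service with distribution $B_2$ is in progress at time $t$, and $q_i=\lim_{t\to\infty}\Pr\{L_t=i\}$, $i=1,\dots,L$. Costs.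 $j_1,j_2$ are given real constants. For each $L$ a positive non-increasing finite sequence $c_1\ge c_2\ge\dots\ge c_L$ is given (it may depend on $L$; the first value $c_1$ and the last value $c_L$ are fixed and strictly positive as $L$ varies), and the limits of cost averages that occur are taken to exist. The objective function is $J=J(L)=p_1j_1L+p_2j_2L+\sum_{i=1}^Lc_iq_i$. Control problem. $\lambda$, $(r_i)$ and $B_2$ are fixed, while $B_1=B_{1,L}$ (hence $\rho_1=\rho_1(L)$) may be chosen. The problem is to choose $\rho_1$ so as to minimize the limiting value of $J(L)$ as $L\to\infty$. The candidates are $\rho_1=1$, $\rho_1=1+\delta$ and $\rho_1=1-\delta$, with $\delta=\delta(L)>0$, $\delta\to0$ and $\delta L\to C\ge0$ as $L\to\infty$; in the last two cases the limiting values of $J$ are denoted $J^{\mathrm{upper}}(C)$ and $J^{\mathrm{lower}}(C)$. With $D=\widetilde\rho_{1,2}(\mathsf E\varsigma)^3+\mathsf E[\varsigma^2]-\mathsf E\varsigma$, $\theta=2\mathsf E\varsigma/D$ and $\widehat C_L(z)=\sum_{j=0}^{L-1}c_{L-j}z^j$, they are, for $C>0$, $$J^{\mathrm{upper}}(C)=C\left[j_1\frac{1}{e^{\theta C}-1}+j_2\frac{\rho_2e^{\theta C}}{(1-\rho_2)(e^{\theta C}-1)}\right]+\theta C\frac{e^{\theta C}}{e^{\theta C}-1}\lim_{L\to\infty}\frac1L\widehat C_L\!\left(1-\frac{\theta C}{L}\right),$$ $$J^{\mathrm{lower}}(C)=C\left[j_1 e^{1/(\theta C)}+j_2\frac{\rho_2}{1-\rho_2}\left(e^{1/(\theta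 C)}-1\right)\right]+\frac{\theta C}{e^{\theta C}-1}\lim_{L\to\infty}\frac1L\widehat C_L\!\left(1+\frac{\theta C}{L}\right),$$ and $J^{\mathrm{upper}}(0)=J^{\mathrm{lower}}(0)=\frac{j_1}{\theta}+\frac{j_2\rho_2}{(1-\rho_2)\theta}+\lim_{L\to\infty}\frac1L\sum_{i=1}^Lc_i$. The solution is $\rho_1=1$ exactly when both $J^{\mathrm{upper}}$ and $J^{\mathrm{lower}}$ attain their minima over $C\ge0$ at $C=0$. Regularity conditions. (A) The sequence $\rho_{1,3}(L)$ is bounded, $\mathsf E[\varsigma^3]<\infty$, and $\widetilde\rho_{1,2}=\lim_{L\to\infty}\rho_{1,2}(L)$ exists. (B) (For the case $\rho_1=1-\delta$.) The family of distributions $B_1$ and the distribution of $\varsigma$ are such that the equation $z=\widehat B_1(\lambda-\lambda\widehat R(z))$ has a unique root $\tau>1$, and $\widehat B_1'(\lambda-\lambda\widehat R(\tau))$ exists. More precisely, there is $\epsilon_0>0$ such that the members $B_{1,\epsilon}$, $0\le\epsilon\le\epsilon_0$, of the family (the parameter $\epsilon$ being continuously connected with $\delta$) have Laplace--Stieltjes transforms $\widehat B_{1,\epsilon}(s)$ that are analytic in a small neighbourhood of zero, with $\widehat B_{1,\epsilon}'(s)<\infty$ there, and $\widehat R'(1+\epsilon)<\infty$ for all such $\epsilon$.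
   Formalization: In case of equality, c_i ≡ c is proved only asymptotically, uniformly for εL ≤ i ≤ (1−ε)L, and exactly (L ≥ 2) for costs sampled from a continuous profile; literally it fails, e.g. j_1=j_2=0, c_1=2, other c_i=1. The printed formula for J^lower(C), C>0, is not assumed. *)

theory Defs
  imports "HOL-Probability.Probability"
begin

section \<open>Primitive data\<close>

definition service_law :: "real measure \<Rightarrow> bool" where
  "service_law B \<longleftrightarrow> prob_space B \<and> sets B = sets borel \<and> (AE x in B. 0 \<le> x) \<and>
     integrable B (\<lambda>x. x) \<and> 0 < (\<integral>x. x \<partial>B)"

definition batch_moment :: "nat pmf \<Rightarrow> nat \<Rightarrow> real" where
  "batch_moment r k = measure_pmf.expectation r (\<lambda>i. real i ^ k)"

definition load :: "real \<Rightarrow> nat pmf \<Rightarrow> real measure \<Rightarrow> real" where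
  "load lam r B = lam * batch_moment r 1 * (\<integral>x. x \<partial>B)"

definition scaled_moment :: "real \<Rightarrow> nat \<Rightarrow> real measure \<Rightarrow> real" where
  "scaled_moment lam l B = lam ^ l * (\<integral>x. x ^ l \<partial>B)"

definition lst :: "real measure \<Rightarrow> complex \<Rightarrow> complex" where
  "lst B s = (\<integral>x. exp (- (s * of_real x)) \<partial>B)"

definition batch_gf :: "nat pmf \<Rightarrow> real \<Rightarrow> real" where
  "batch_gf r z = (\<Sum>i. pmf r i * z ^ i)"


section \<open>The queue\<close>

text \<open>A sample point is a sequence of independent quadruples; its \<open>k\<close>-th entry consists of the time
  between batch arrivals \<open>k - 1\<close> and \<open>k\<close>, the size of batch \<open>k\<close>, and the two candidate service
  times (distributed as \<open>B1\<close> and \<open>B2\<close>) of customer \<open>k\<close>. Batches and customers are numbered from 0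
  and customers are served in order of arrival; the system is empty at time 0.\<close>

type_synonym sample = "nat \<Rightarrow> real \<times> nat \<times> real \<times> real"

definition queue_space ::
  "real \<Rightarrow> nat pmf \<Rightarrow> real measure \<Rightarrow> real measure \<Rightarrow> sample measure" where
  "queue_space lam r B1 B2 =
     (\<Pi>\<^sub>M k\<in>UNIV. density lborel (exponential_density lam) \<Otimes>\<^sub>M (measure_pmf r \<Otimes>\<^sub>M (B1 \<Otimes>\<^sub>M B2)))"

definition gap :: "sample \<Rightarrow> nat \<Rightarrow> real" where
  "gap w k = fst (w k)"

definition batch :: "sample \<Rightarrow> nat \<Rightarrow> nat" where
  "batch w k = fst (snd (w k))"

definition service1 :: "sample \<Rightarrow> nat \<Rightarrow> real" where
  "service1 w n = fst (snd (snd (w n)))"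

definition service2 :: "sample \<Rightarrow> nat \<Rightarrow> real" where
  "service2 w n = snd (snd (snd (w n)))"

definition batch_epoch :: "sample \<Rightarrow> nat \<Rightarrow> real" where
  "batch_epoch w k = (\<Sum>i\<le>k. gap w i)"

definition arrived :: "sample \<Rightarrow> real \<Rightarrow> nat" where
  "arrived w t = (\<Sum>k | batch_epoch w k \<le> t. batch w k)"

definition arrival :: "sample \<Rightarrow> nat \<Rightarrow> real" where
  "arrival w n = batch_epoch w (LEAST k. n < (\<Sum>i\<le>k. batch w i))"

text \<open>Given the departure time \<open>d\<close> of customer \<open>n\<close>, the queue-length immediately before the service
  of customer \<open>n + 1\<close> begins: 0 if that service opens a busy period, and otherwise the number of
  customers left behind by customer \<open>n\<close>.\<close>

definition queue_seen :: "sample \<Rightarrow> nat \<Rightarrow> real \<Rightarrow> nat" where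
  "queue_seen w n d = (if d < arrival w (Suc n) then 0 else arrived w d - Suc n)"

primrec departure :: "nat \<Rightarrow> sample \<Rightarrow> nat \<Rightarrow> real" where
  "departure L w 0 = arrival w 0 + service1 w 0"
| "departure L w (Suc n) =
     max (arrival w (Suc n)) (departure L w n) +
     (if queue_seen w n (departure L w n) > L then service2 w (Suc n) else service1 w (Suc n))"

definition queue_length :: "nat \<Rightarrow> real \<Rightarrow> sample \<Rightarrow> nat" where
  "queue_length L t w = arrived w t - card {n. departure L w n \<le> t}"

text \<open>Customer 0 finds an empty system, so only the customers \<open>Suc n\<close> can be served
  according to \<open>B2\<close>.\<close>

definition second_service :: "nat \<Rightarrow> real \<Rightarrow> sample \<Rightarrow> bool" where
  "second_service L t w \<longleftrightarrow>
     (\<exists>n. queue_seen w n (departure L w n) > L \<and>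
          max (arrival w (Suc n)) (departure L w n) \<le> t \<and> t < departure L w (Suc n))"

definition limit_prob_length ::
  "real \<Rightarrow> nat pmf \<Rightarrow> real measure \<Rightarrow> real measure \<Rightarrow> nat \<Rightarrow> nat \<Rightarrow> real" where
  "limit_prob_length lam r B1 B2 L i =
     Lim at_top (\<lambda>t. \<P>(w in queue_space lam r B1 B2. queue_length L t w = i))"

definition limit_prob_second ::
  "real \<Rightarrow> nat pmf \<Rightarrow> real measure \<Rightarrow> real measure \<Rightarrow> nat \<Rightarrow> real" where
  "limit_prob_second lam r B1 B2 L =
     Lim at_top (\<lambda>t. \<P>(w in queue_space lam r B1 B2. second_service L t w))"


section \<open>Costs and objective\<close>

text \<open>\<open>c L i\<close> is the cost \<open>c\<^sub>i\<close> in the problem with threshold \<open>L\<close>. That the first and the last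
  value do not depend on \<open>L\<close> is required from \<open>L = 2\<close> on: for \<open>L = 1\<close> they are the same number, and
  the requirement would force all costs to be equal.\<close>

definition cost_family :: "(nat \<Rightarrow> nat \<Rightarrow> real) \<Rightarrow> bool" where
  "cost_family c \<longleftrightarrow>
     (\<forall>L\<ge>1. \<forall>i\<in>{1..L}. 0 < c L i) \<and>
     (\<forall>L\<ge>1. \<forall>i k. 1 \<le> i \<and> i \<le> k \<and> k \<le> L \<longrightarrow> c L k \<le> c L i) \<and>
     (\<exists>c_first c_last. 0 < c_first \<and> 0 < c_last \<and> (\<forall>L\<ge>2. c L 1 = c_first \<and> c L L = c_last))"

definition cost_gf :: "(nat \<Rightarrow> nat \<Rightarrow> real) \<Rightarrow> nat \<Rightarrow> real \<Rightarrow> real" where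
  "cost_gf c L z = (\<Sum>j<L. c L (L - j) * z ^ j)"

definition objective ::
  "real \<Rightarrow> nat pmf \<Rightarrow> real measure \<Rightarrow> real measure \<Rightarrow> real \<Rightarrow> real \<Rightarrow> (nat \<Rightarrow> nat \<Rightarrow> real) \<Rightarrow> nat \<Rightarrow> real"
  where
  "objective lam r B1 B2 j1 j2 c L =
     limit_prob_length lam r B1 B2 L 0 * j1 * real L +
     limit_prob_second lam r B1 B2 L * j2 * real L +
     (\<Sum>i=1..L. c L i * limit_prob_length lam r B1 B2 L i)"


section \<open>Controls and regularity conditions\<close>

text \<open>A control is a sequence \<open>B1\<close> of service laws, \<open>B1 L\<close> being used with threshold \<open>L\<close>. The
  load \<open>1\<close> is admitted as a control with \<open>C = 0\<close> in both cases below.\<close>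

definition vanishing_deviation :: "(nat \<Rightarrow> real) \<Rightarrow> real \<Rightarrow> bool" where
  "vanishing_deviation \<delta> C \<longleftrightarrow>
     ((\<forall>L\<ge>1. 0 < \<delta> L) \<or> (C = 0 \<and> (\<forall>L\<ge>1. \<delta> L = 0))) \<and>
     \<delta> \<longlonglongrightarrow> 0 \<and> (\<lambda>L. \<delta> L * real L) \<longlonglongrightarrow> C"

definition upper_control :: "real \<Rightarrow> nat pmf \<Rightarrow> real \<Rightarrow> (nat \<Rightarrow> real measure) \<Rightarrow> bool" where
  "upper_control lam r C B1 \<longleftrightarrow> (\<forall>L\<ge>1. service_law (B1 L)) \<and>
     (\<exists>\<delta>. vanishing_deviation \<delta> C \<and> (\<forall>L\<ge>1. load lam r (B1 L) = 1 + \<delta> L))"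

definition lower_control :: "real \<Rightarrow> nat pmf \<Rightarrow> real \<Rightarrow> (nat \<Rightarrow> real measure) \<Rightarrow> bool" where
  "lower_control lam r C B1 \<longleftrightarrow> (\<forall>L\<ge>1. service_law (B1 L)) \<and>
     (\<exists>\<delta>. vanishing_deviation \<delta> C \<and> (\<forall>L\<ge>1. load lam r (B1 L) = 1 - \<delta> L))"

definition condition_A :: "real \<Rightarrow> nat pmf \<Rightarrow> real \<Rightarrow> (nat \<Rightarrow> real measure) \<Rightarrow> bool" where
  "condition_A lam r rho12 B1 \<longleftrightarrow>
     (\<forall>L\<ge>1. integrable (B1 L) (\<lambda>x. x ^ 3)) \<and>
     (\<exists>K. \<forall>L\<ge>1. scaled_moment lam 3 (B1 L) \<le> K) \<and>
     integrable (measure_pmf r) (\<lambda>i. real i ^ 3) \<and>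
     (\<lambda>L. scaled_moment lam 2 (B1 L)) \<longlonglongrightarrow> rho12"

text \<open>Divergent series and integrals have junk values, so convergence is part of being a root.\<close>

definition root_above_one :: "real \<Rightarrow> nat pmf \<Rightarrow> real measure \<Rightarrow> real \<Rightarrow> bool" where
  "root_above_one lam r B \<tau> \<longleftrightarrow> 1 < \<tau> \<and>
     summable (\<lambda>i. pmf r i * \<tau> ^ i) \<and>
     integrable B (\<lambda>x. exp (- ((lam - lam * batch_gf r \<tau>) * x))) \<and>
     lst B (of_real (lam - lam * batch_gf r \<tau>)) = of_real \<tau>"

text \<open>In the second part the members of the control are drawn from a family \<open>F \<epsilon>\<close>, where
  \<open>\<epsilon> = g \<delta>\<close> is a continuous function of the deviation \<open>\<delta> = 1 - load\<close>. There is no root above 1 when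
  the load is 1, whence the restriction on the load in the first part.\<close>

definition condition_B :: "real \<Rightarrow> nat pmf \<Rightarrow> (nat \<Rightarrow> real measure) \<Rightarrow> bool" where
  "condition_B lam r B1 \<longleftrightarrow>
     (\<forall>L\<ge>1. load lam r (B1 L) < 1 \<longrightarrow>
        (\<exists>\<tau>. root_above_one lam r (B1 L) \<tau> \<and>
             (\<forall>\<tau>'. root_above_one lam r (B1 L) \<tau>' \<longrightarrow> \<tau>' = \<tau>) \<and>
             lst (B1 L) field_differentiable at (of_real (lam - lam * batch_gf r \<tau>)))) \<and>
     (\<exists>\<epsilon>0>0. \<exists>F g.
        continuous_on {0..} g \<and> g 0 = 0 \<and>
        (\<forall>\<^sub>F L in sequentially. g (1 - load lam r (B1 L)) \<in> {0..\<epsilon>0} \<and>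
           B1 L = F (g (1 - load lam r (B1 L)))) \<and>
        (\<exists>\<eta>>0. \<forall>\<epsilon>\<in>{0..\<epsilon>0}.
           (\<forall>s\<in>ball 0 \<eta>. integrable (F \<epsilon>) (\<lambda>x. exp (- (s * complex_of_real x)))) \<and>
           lst (F \<epsilon>) holomorphic_on ball 0 \<eta>) \<and>
        (\<forall>\<epsilon>\<in>{0..\<epsilon>0}. summable (\<lambda>i. real i * pmf r i * (1 + \<epsilon>) ^ (i - 1))))"


section \<open>Limiting values of the objective\<close>

definition theta :: "nat pmf \<Rightarrow> real \<Rightarrow> real" where
  "theta r rho12 =
     2 * batch_moment r 1 /
     (rho12 * batch_moment r 1 ^ 3 + batch_moment r 2 - batch_moment r 1)"

definition cost_limits_exist :: "real \<Rightarrow> (nat \<Rightarrow> nat \<Rightarrow> real) \<Rightarrow> bool" where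
  "cost_limits_exist \<theta> c \<longleftrightarrow>
     convergent (\<lambda>L. (\<Sum>i=1..L. c L i) / real L) \<and>
     (\<forall>C>0. convergent (\<lambda>L. cost_gf c L (1 - \<theta> * C / real L) / real L) \<and>
            convergent (\<lambda>L. cost_gf c L (1 + \<theta> * C / real L) / real L))"

definition J_zero :: "real \<Rightarrow> real \<Rightarrow> real \<Rightarrow> real \<Rightarrow> (nat \<Rightarrow> nat \<Rightarrow> real) \<Rightarrow> real" where
  "J_zero \<theta> rho2 j1 j2 c =
     j1 / \<theta> + j2 * rho2 / ((1 - rho2) * \<theta>) + lim (\<lambda>L. (\<Sum>i=1..L. c L i) / real L)"

definition J_upper :: "real \<Rightarrow> real \<Rightarrow> real \<Rightarrow> real \<Rightarrow> (nat \<Rightarrow> nat \<Rightarrow> real) \<Rightarrow> real \<Rightarrow> real" where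
  "J_upper \<theta> rho2 j1 j2 c C =
     C * (j1 * (1 / (exp (\<theta> * C) - 1)) +
          j2 * (rho2 * exp (\<theta> * C) / ((1 - rho2) * (exp (\<theta> * C) - 1)))) +
     \<theta> * C * (exp (\<theta> * C) / (exp (\<theta> * C) - 1)) *
       lim (\<lambda>L. cost_gf c L (1 - \<theta> * C / real L) / real L)"

text \<open>\<open>Jup\<close> and \<open>Jlow\<close> are the limiting values of the objective for the loads \<open>1 + \<delta>\<close> and \<open>1 - \<delta>\<close> as
  functions of \<open>C\<close>. No closed form of \<open>Jlow C\<close> for positive \<open>C\<close> is prescribed anywhere: the published
  one, with the factor \<open>exp (1 / (\<theta> * C))\<close>, is unbounded as \<open>C\<close> tends to 0 (unless the
  coefficient \<open>j1 + j2 * rho2 / (1 - rho2)\<close> vanishes) and is not the limiting value of the objective, so imposing it on \<open>Jlow\<close> could make the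
  hypotheses contradictory.\<close>

definition unit_load_optimal :: "(real \<Rightarrow> real) \<Rightarrow> (real \<Rightarrow> real) \<Rightarrow> bool" where
  "unit_load_optimal Jup Jlow \<longleftrightarrow>
     is_arg_min Jup (\<lambda>C. 0 \<le> C) 0 \<and> is_arg_min Jlow (\<lambda>C. 0 \<le> C) 0"

text \<open>The objective is minimized in the limit \<open>L \<rightarrow> \<infinity>\<close> and the limiting values do not see the costs at
  levels \<open>o(L)\<close> or \<open>L - o(L)\<close>: changing \<open>c\<^sub>1\<close> alone changes none of them. So \<open>c\<^sub>i = \<kappa>\<close> for all \<open>i\<close> has to
  be read up to such boundary levels.\<close>

definition asymptotically_constant :: "(nat \<Rightarrow> nat \<Rightarrow> real) \<Rightarrow> real \<Rightarrow> bool" where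
  "asymptotically_constant c \<kappa> \<longleftrightarrow>
     (\<forall>\<epsilon>>0. \<forall>\<^sub>F L in sequentially. \<forall>i\<in>{1..L}.
        \<epsilon> * real L \<le> real i \<and> real i \<le> (1 - \<epsilon>) * real L \<longrightarrow> \<bar>c L i - \<kappa>\<bar> < \<epsilon>)"

text \<open>Costs sampled from a continuous function of the relative level, the first and the last cost being
  the values at the end points of the unit interval; they have no boundary layers.\<close>

definition cost_profile :: "(nat \<Rightarrow> nat \<Rightarrow> real) \<Rightarrow> (real \<Rightarrow> real) \<Rightarrow> bool" where
  "cost_profile c f \<longleftrightarrow> continuous_on {0..1} f \<and>
     (\<forall>L\<ge>2. \<forall>i\<in>{1..L}. c L i = f ((real i - 1) / (real L - 1)))"

end

theory Submission
  imports Defs "HOL-Real_Asymp.Real_Asymp"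
begin

text \<open>Put \<open>a = j2 * rho2 / (1 - rho2)\<close> and substitute \<open>x = \<theta> * C\<close>. Write \<open>A\<close> for the limit of the
  average costs and \<open>S x\<close> for the limit of \<open>cost_gf c L (1 - x / L) / L\<close>. The values of the objective
  for the loads \<open>1\<close> and \<open>1 + \<delta>\<close> are then

  \<open>(j1 + a) / \<theta> + A\<close> and
  \<open>(j1 * x / (exp x - 1) + a * x * exp x / (exp x - 1)) / \<theta> + \<psi> x\<close> with
  \<open>\<psi> x = x / (1 - exp (- x)) * S x\<close>.

  The number \<open>\<psi> x\<close> is a weighted average of the costs: in the limit the relative level \<open>u\<close> has the
  probability density \<open>x * exp (x * u) / (exp x - 1)\<close>. This density increases in \<open>u\<close> and the costs
  do not, so \<open>\<psi> x \<le> A\<close> by Chebyshev's sum inequality: a load slightly above 1 favours the high and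
  cheap levels. On the other hand the first part changes by
  \<open>(a - j1) * x / (2 * \<theta>) + O(x\<^sup>2)\<close>. Optimality of \<open>x = 0\<close> therefore forces \<open>j1 \<le> a\<close>.

  For the case of equality Chebyshev's inequality is needed with a remainder
  (\<open>Chebyshev_sum_upper_remainder\<close>). If, for some \<open>e < 1 / 2\<close> and infinitely many \<open>L\<close>, the costs fall by
  at least \<open>h > 0\<close> between the levels \<open>e * L\<close> and \<open>(1 - e) * L\<close>, then \<open>\<psi> x\<close> is below \<open>A\<close> by at
  least \<open>K * x\<close> with a constant \<open>K > 0\<close> (\<open>discounted_cost_limit_gap\<close>), and comparing the terms of
  first order yields \<open>2 * \<theta> * K \<le> a - j1\<close> (\<open>optimality_first_order\<close>). So \<open>j1 = a\<close> leaves
  no such fall, and bounded monotone costs whose fall over the middle levels tends to 0 approach their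
  average there (\<open>asymptotically_constantI\<close>). The divisions by \<open>\<theta>\<close> presuppose \<open>\<theta> > 0\<close>, which
  holds because the second moment of a service time is at least the square of its mean, and the
  means are bounded away from 0 since the loads tend to 1 (\<open>theta_pos\<close>).\<close>

section \<open>Chebyshev's sum inequality with a remainder\<close>

lemma sum_product_pairwise_differences:
  fixes a b :: "nat \<Rightarrow> real"
  shows "(\<Sum>i<n. \<Sum>j<n. (a j - a i) * (b i - b j)) =
    2 * ((\<Sum>k<n. a k) * (\<Sum>k<n. b k) - real n * (\<Sum>k<n. a k * b k))"
proof -
  have "(\<Sum>i<n. \<Sum>j<n. (a j - a i) * (b i - b j)) =
      (\<Sum>i<n. \<Sum>j<n. a j * b i) + (\<Sum>i<n. \<Sum>j<n. a i * b j)
      - real n * (\<Sum>k<n. a k * b k) - real n * (\<Sum>k<n. a k * b k)"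
    by (simp add: left_diff_distrib right_diff_distrib sum.distrib sum_subtractf sum_distrib_left)
  moreover have "(\<Sum>i<n. \<Sum>j<n. a j * b i) = (\<Sum>k<n. a k) * (\<Sum>k<n. b k)"
    by (subst sum.swap) (simp add: sum_product)
  moreover have "(\<Sum>i<n. \<Sum>j<n. a i * b j) = (\<Sum>k<n. a k) * (\<Sum>k<n. b k)"
    by (simp add: sum_product)
  ultimately show ?thesis
    unfolding right_diff_distrib by linarith
qed

text \<open>All pairwise products of differences are nonnegative for oppositely ordered sequences, so the
  inequality is strengthened by the \<open>m\<^sup>2\<close> pairs that consist of one of the first and one of the last \<open>m\<close>
  indices. Each pair is counted in one of its two orders only, whence the factor \<open>1 / 2\<close>.\<close>

lemma Chebyshev_sum_upper_remainder:
  fixes a b :: "nat \<Rightarrow> real"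
  assumes a: "\<And>i j. i \<le> j \<Longrightarrow> j < n \<Longrightarrow> a i \<le> a j"
    and b: "\<And>i j. i \<le> j \<Longrightarrow> j < n \<Longrightarrow> b j \<le> b i"
    and "m \<le> n" "0 \<le> h" "0 \<le> d"
    and h: "\<And>i j. i < m \<Longrightarrow> n - m \<le> j \<Longrightarrow> j < n \<Longrightarrow> h \<le> a j - a i"
    and d: "\<And>i j. i < m \<Longrightarrow> n - m \<le> j \<Longrightarrow> j < n \<Longrightarrow> d \<le> b i - b j"
  shows "real n * (\<Sum>k<n. a k * b k) + (real m)\<^sup>2 * (h * d) / 2 \<le> (\<Sum>k<n. a k) * (\<Sum>k<n. b k)"
proof -
  let ?f = "\<lambda>i j. (a j - a i) * (b i - b j)"
  have nonneg: "0 \<le> ?f i j" if "i < n" "j < n" for i j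
    using a[of i j] a[of j i] b[of i j] b[of j i] that
    by (cases "i \<le> j") (auto intro: mult_nonneg_nonneg mult_nonpos_nonpos)
  have "(real m)\<^sup>2 * (h * d) = (\<Sum>i<m. \<Sum>j\<in>{n-m..<n}. h * d)"
    using \<open>m \<le> n\<close> by (simp add: power2_eq_square)
  also have "\<dots> \<le> (\<Sum>i<m. \<Sum>j\<in>{n-m..<n}. ?f i j)"
    using h d \<open>0 \<le> h\<close> \<open>0 \<le> d\<close> by (intro sum_mono mult_mono) (force intro: order_trans[of 0 h])+
  also have "\<dots> \<le> (\<Sum>i<m. \<Sum>j<n. ?f i j)"
    using nonneg \<open>m \<le> n\<close> by (intro sum_mono sum_mono2) auto
  also have "\<dots> \<le> (\<Sum>i<n. \<Sum>j<n. ?f i j)"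
    using nonneg \<open>m \<le> n\<close> by (intro sum_mono2 sum_nonneg) auto
  finally show ?thesis
    unfolding sum_product_pairwise_differences by (simp add: field_simps)
qed

text \<open>The difference is a sum of \<open>j - i\<close> steps \<open>y ^ k * (1 - y)\<close> with \<open>k < j\<close>.\<close>

lemma power_diff_lower_bound:
  fixes y :: real
  assumes "0 \<le> y" "y \<le> 1" "i \<le> j"
  shows "(real j - real i) * (1 - y) * y ^ j \<le> y ^ i - y ^ j"
  using \<open>i \<le> j\<close>
proof (induction j rule: dec_induct)
  case base
  show ?case by simp
next
  case (step n)
  have "(real (Suc n) - real i) * (1 - y) * y ^ Suc n \<le> (real (Suc n) - real i) * (1 - y) * y ^ n"
    using assms step by (intro mult_left_mono) (auto intro: mult_left_le_one_le)
  also have "\<dots> = (real n - real i) * (1 - y) * y ^ n + (y ^ n - y ^ Suc n)"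
    by (simp add: algebra_simps)
  finally show ?case using step.IH by simp
qed


section \<open>Discounted costs\<close>

text \<open>The remainder form of Chebyshev's inequality for the costs, listed from level \<open>L\<close> downwards, and
  the powers of \<open>1 - x / L\<close>. Exponents below \<open>m\<close> differ from those in the last block of length \<open>m\<close> by
  at least \<open>L - 2 * m\<close>, and a single step costs at least \<open>x / (2 * L)\<close>, because \<open>(1 - x / L) ^ L\<close> does
  not fall below \<open>1 - x \<ge> 1 / 2\<close>. So the powers drop by at least \<open>(1 - 2 * m / L) * x / 2\<close>, a
  bound in which \<open>L\<close> enters only through the ratio \<open>m / L\<close>.\<close>

lemma discounted_cost_gap:
  assumes antimono: "\<And>i k. 1 \<le> i \<Longrightarrow> i \<le> k \<Longrightarrow> k \<le> L \<Longrightarrow> c L k \<le> c L i"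
    and "2 * m < L" "0 \<le> h" "h \<le> c L (Suc m) - c L (L - m)" "0 < x" "x \<le> 1 / 2"
  shows "cost_gf c L (1 - x / real L) / real L + (real m / real L)\<^sup>2 * (1 - 2 * (real m / real L)) * (h * x / 4)
    \<le> (\<Sum>i=1..L. c L i) / real L * ((\<Sum>j<L. (1 - x / real L) ^ j) / real L)"
proof -
  define y where "y = 1 - x / real L"
  define l where "l = real L"
  have L: "1 \<le> l" "l > 0" "2 * real m < l" using assms(2) by (auto simp: l_def)
  have y: "0 \<le> y" "y \<le> 1" using assms L by (auto simp: y_def l_def[symmetric] divide_simps)
  have yL: "1 / 2 \<le> y ^ L"
  proof -
    have "1 + real L * (- (x / real L)) \<le> (1 + - (x / real L)) ^ L"
      using assms L by (intro Bernoulli_inequality) (auto simp: l_def[symmetric] divide_simps)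
    then show ?thesis using assms L by (simp add: y_def l_def)
  qed
  define d where "d = (1 - 2 * (real m / l)) * x / 2"
  have "0 \<le> d" using L assms by (auto simp: d_def divide_simps)
  have "real L * (\<Sum>k<L. c L (L - k) * y ^ k) + (real m)\<^sup>2 * (h * d) / 2
      \<le> (\<Sum>k<L. c L (L - k)) * (\<Sum>k<L. y ^ k)"
  proof (rule Chebyshev_sum_upper_remainder)
    show "c L (L - i) \<le> c L (L - j)" if "i \<le> j" "j < L" for i j
      using that by (intro antimono) auto
    show "y ^ j \<le> y ^ i" if "i \<le> j" "j < L" for i j
      using that y by (intro power_decreasing) auto
    show "h \<le> c L (L - j) - c L (L - i)" if "i < m" "L - m \<le> j" "j < L" for i j
    proof -
      have "c L (Suc m) \<le> c L (L - j)" "c L (L - i) \<le> c L (L - m)"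
        using that assms(2) by (auto intro!: antimono)
      then show ?thesis using assms by linarith
    qed
    show "d \<le> y ^ i - y ^ j" if "i < m" "L - m \<le> j" "j < L" for i j
    proof -
      have ij: "l - 2 * real m \<le> real j - real i" using that assms(2) by (auto simp: l_def)
      have "y ^ L \<le> y ^ j" using that y by (intro power_decreasing) auto
      then have "1 / 2 \<le> y ^ j" using yL by linarith
      have "d = (l - 2 * real m) * (1 - y) * (1 / 2)"
        using L by (simp add: d_def y_def l_def[symmetric] field_simps)
      also have "\<dots> \<le> (real j - real i) * (1 - y) * y ^ j"
        using ij \<open>1 / 2 \<le> y ^ j\<close> y L by (intro mult_mono) auto
      also have "\<dots> \<le> y ^ i - y ^ j"
        using that y assms(2) by (intro power_diff_lower_bound) auto
      finally show ?thesis .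
    qed
  qed (use assms \<open>0 \<le> d\<close> in auto)
  moreover have "(\<Sum>k<L. c L (L - k)) = (\<Sum>i=1..L. c L i)"
    by (rule sum.reindex_bij_witness[of _ "\<lambda>i. L - i" "\<lambda>j. L - j"]) auto
  ultimately have "l * cost_gf c L y + (real m)\<^sup>2 * (h * d) / 2 \<le> (\<Sum>i=1..L. c L i) * (\<Sum>k<L. y ^ k)"
    by (simp add: cost_gf_def l_def)
  then have "(l * cost_gf c L y + (real m)\<^sup>2 * (h * d) / 2) / l\<^sup>2 \<le> (\<Sum>i=1..L. c L i) * (\<Sum>k<L. y ^ k) / l\<^sup>2"
    by (intro divide_right_mono) auto
  moreover have "(l * cost_gf c L y + (real m)\<^sup>2 * (h * d) / 2) / l\<^sup>2 =
      cost_gf c L y / l + (real m / l)\<^sup>2 * (1 - 2 * (real m / l)) * (h * x / 4)"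
    using L by (simp add: d_def field_simps power2_eq_square)
  ultimately show ?thesis
    by (simp add: y_def l_def power2_eq_square)
qed

text \<open>Passage to the limit \<open>L \<rightarrow> \<infinity>\<close> with \<open>m = \<lfloor>e * L\<rfloor>\<close>. Infinitely many \<open>L\<close> with a fall of at
  least \<open>h\<close> suffice, as both sides converge along the whole sequence; the negation of the
  conclusion can therefore be used to show that the fall is eventually smaller than \<open>h\<close>.\<close>

lemma discounted_cost_limit_gap:
  assumes antimono: "\<And>L i k. 1 \<le> i \<Longrightarrow> i \<le> k \<Longrightarrow> k \<le> L \<Longrightarrow> c L k \<le> c L i"
    and e: "0 < e" "e < 1 / 2" and "0 \<le> h" and x: "0 < x" "x \<le> 1 / 2"
    and osc: "\<exists>\<^sub>F L in sequentially.
      h \<le> c L (Suc (nat \<lfloor>e * real L\<rfloor>)) - c L (L - nat \<lfloor>e * real L\<rfloor>)"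
    and A: "(\<lambda>L. (\<Sum>i=1..L. c L i) / real L) \<longlonglongrightarrow> A"
    and S: "(\<lambda>L. cost_gf c L (1 - x / real L) / real L) \<longlonglongrightarrow> S"
  shows "S + e\<^sup>2 * (1 - 2 * e) * (h * x / 4) \<le> A * ((1 - exp (- x)) / x)"
proof -
  let ?m = "\<lambda>L. nat \<lfloor>e * real L\<rfloor>"
  let ?U = "\<lambda>L. cost_gf c L (1 - x / real L) / real L +
    (real (?m L) / real L)\<^sup>2 * (1 - 2 * (real (?m L) / real L)) * (h * x / 4)"
  let ?V = "\<lambda>L. (\<Sum>i=1..L. c L i) / real L * ((\<Sum>j<L. (1 - x / real L) ^ j) / real L)"
  have "(\<lambda>L::nat. real_of_int \<lfloor>e * real L\<rfloor> / real L) \<longlonglongrightarrow> e"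
    using e by real_asymp
  then have m: "(\<lambda>L. real (?m L) / real L) \<longlonglongrightarrow> e"
    using e by simp
  have U: "?U \<longlonglongrightarrow> S + e\<^sup>2 * (1 - 2 * e) * (h * x / 4)"
    by (intro tendsto_intros S m)
  have "(\<lambda>L. (1 - (1 - x / real L) ^ L) / x) \<longlonglongrightarrow> (1 - exp (- x)) / x"
    using tendsto_exp_limit_sequentially[of "- x"] x by (intro tendsto_intros) auto
  moreover have "\<forall>\<^sub>F L in sequentially. (1 - (1 - x / real L) ^ L) / x = (\<Sum>j<L. (1 - x / real L) ^ j) / real L"
    using eventually_gt_at_top[of 0]
  proof eventually_elim
    case (elim L)
    then show ?case using x sum_gp_strict[of "1 - x / real L" L] by (simp add: field_simps)
  qed
  ultimately have "(\<lambda>L. (\<Sum>j<L. (1 - x / real L) ^ j) / real L) \<longlonglongrightarrow> (1 - exp (- x)) / x"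
    by (rule Lim_transform_eventually)
  then have V: "?V \<longlonglongrightarrow> A * ((1 - exp (- x)) / x)"
    by (rule tendsto_mult[OF A])
  have "\<exists>\<^sub>F L in sequentially. ?U L \<le> ?V L"
    using osc
  proof (rule frequently_rev_mp)
    show "\<forall>\<^sub>F L in sequentially. h \<le> c L (Suc (?m L)) - c L (L - ?m L) \<longrightarrow> ?U L \<le> ?V L"
      using eventually_gt_at_top[of 0]
    proof eventually_elim
      case (elim L)
      have "real (?m L) \<le> e * real L" using e by simp
      also have "\<dots> < 1 / 2 * real L" using e elim by (intro mult_strict_right_mono) auto
      finally have "2 * ?m L < L" by linarith
      then show ?case
        using discounted_cost_gap[of L c "?m L" h x, OF antimono] \<open>0 \<le> h\<close> x by blast
    qed
  qed
  show ?thesis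
  proof (rule ccontr)
    assume "\<not> ?thesis"
    then obtain t where t: "t < S + e\<^sup>2 * (1 - 2 * e) * (h * x / 4)" "A * ((1 - exp (- x)) / x) < t"
      using dense not_le by metis
    have "\<forall>\<^sub>F L in sequentially. \<not> ?U L \<le> ?V L"
      using order_tendstoD(1)[OF U t(1)] order_tendstoD(2)[OF V t(2)]
      by eventually_elim linarith
    with \<open>\<exists>\<^sub>F L in sequentially. ?U L \<le> ?V L\<close> show False
      by (simp add: frequently_def)
  qed
qed

text \<open>Both bounds are combined to eliminate \<open>S x\<close>: the weight \<open>x * exp x / (exp x - 1)\<close> in the objective
  is the reciprocal of the factor \<open>(1 - exp (- x)) / x\<close> of \<open>A\<close>, so \<open>A\<close> cancels. What remains is
  divided by \<open>x\<close>; as \<open>x \<rightarrow> 0\<close>, the slopes \<open>- 1 / 2\<close> of \<open>x / (exp x - 1)\<close> and \<open>1 / 2\<close> of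
  \<open>x * exp x / (exp x - 1)\<close> appear.\<close>

lemma optimality_first_order:
  fixes S :: "real \<Rightarrow> real"
  assumes "0 < \<theta>"
    and gap: "\<And>x. 0 < x \<Longrightarrow> x \<le> 1 / 2 \<Longrightarrow> S x + K * x \<le> A * ((1 - exp (- x)) / x)"
    and opt: "\<And>x. 0 < x \<Longrightarrow> x \<le> 1 / 2 \<Longrightarrow> (j1 + a) / \<theta> + A \<le>
      x / \<theta> * ((j1 + a * exp x) / (exp x - 1)) + x * exp x / (exp x - 1) * S x"
  shows "2 * \<theta> * K \<le> a - j1"
proof -
  let ?l = "\<lambda>x. \<theta> * K * (x * exp x / (exp x - 1))"
  let ?r = "\<lambda>x. (x * ((j1 + a * exp x) / (exp x - 1)) - (j1 + a)) / x"
  have ev: "\<forall>\<^sub>F x in at_right 0. ?l x \<le> ?r x"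
    using eventually_at_right_real[of 0 "1/2"]
  proof (rule eventually_mono)
    fix x :: real assume "x \<in> {0<..<1/2}"
    then have x: "0 < x" "x \<le> 1 / 2" by auto
    define w where "w = x * exp x / (exp x - 1)"
    have "1 < exp x" using x by simp
    then have "0 < w" using x by (simp add: w_def)
    have "w * (S x + K * x) \<le> w * (A * ((1 - exp (- x)) / x))"
      using gap[OF x] \<open>0 < w\<close> by (intro mult_left_mono) auto
    also have "\<dots> = A"
      using x \<open>1 < exp x\<close> by (simp add: w_def exp_minus field_simps)
    finally have "w * S x \<le> A - K * x * w" by (simp add: algebra_simps)
    moreover define v where "v = (j1 + a * exp x) / (exp x - 1)"
    ultimately have "(j1 + a) / \<theta> + K * x * w \<le> x / \<theta> * v"
      using opt[OF x] unfolding w_def[symmetric] by simp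
    then have "\<theta> * ((j1 + a) / \<theta> + K * x * w) \<le> \<theta> * (x / \<theta> * v)"
      using \<open>0 < \<theta>\<close> by (intro mult_left_mono) auto
    moreover have "\<theta> * ((j1 + a) / \<theta> + K * x * w) = (j1 + a) + \<theta> * K * w * x" "\<theta> * (x / \<theta> * v) = x * v"
      using \<open>0 < \<theta>\<close> by (simp_all add: field_simps)
    ultimately have "(j1 + a) + \<theta> * K * w * x \<le> x * v"
      by simp
    then show "?l x \<le> ?r x"
      using x unfolding w_def[symmetric] v_def[symmetric] by (simp add: le_divide_eq)
  qed simp
  have "((\<lambda>x::real. x * exp x / (exp x - 1)) \<longlongrightarrow> 1) (at_right 0)"
    by real_asymp
  from tendsto_mult[OF tendsto_const this] have l: "(?l \<longlongrightarrow> \<theta> * K * 1) (at_right 0)" .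
  have p: "((\<lambda>x::real. (x / (exp x - 1) - 1) / x) \<longlongrightarrow> -1/2) (at_right 0)"
    by real_asymp
  have q: "((\<lambda>x::real. (x * exp x / (exp x - 1) - 1) / x) \<longlongrightarrow> 1/2) (at_right 0)"
    by real_asymp
  have "?r = (\<lambda>x. j1 * ((x / (exp x - 1) - 1) / x) + a * ((x * exp x / (exp x - 1) - 1) / x))"
    by (rule ext) (simp add: add_divide_distrib diff_divide_distrib algebra_simps)
  then have r: "(?r \<longlongrightarrow> j1 * (-1/2) + a * (1/2)) (at_right 0)"
    by (simp only: tendsto_add[OF tendsto_mult[OF tendsto_const p] tendsto_mult[OF tendsto_const q]])
  have "\<theta> * K * 1 \<le> j1 * (-1/2) + a * (1/2)"
    by (rule tendsto_le[OF _ r l ev]) simp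
  then show ?thesis by simp
qed


section \<open>Asymptotically constant costs\<close>

text \<open>By monotonicity a small fall between the levels \<open>e * L\<close> and \<open>(1 - e) * L\<close> makes all costs in between
  nearly equal. The remaining levels are a fraction \<open>2 * e\<close> of all and contribute at most \<open>2 * e * M\<close>
  to an average, so the common value is near the average \<open>A\<close> of all costs.\<close>

lemma asymptotically_constantI:
  assumes antimono: "\<And>L i k. 1 \<le> i \<Longrightarrow> i \<le> k \<Longrightarrow> k \<le> L \<Longrightarrow> c L k \<le> c L i"
    and bounds: "\<And>L i. 2 \<le> L \<Longrightarrow> 1 \<le> i \<Longrightarrow> i \<le> L \<Longrightarrow> 0 \<le> c L i \<and> c L i \<le> M"
    and osc: "\<And>e h. 0 < e \<Longrightarrow> e < 1 / 2 \<Longrightarrow> 0 < h \<Longrightarrow> \<forall>\<^sub>F L in sequentially.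
      c L (Suc (nat \<lfloor>e * real L\<rfloor>)) - c L (L - nat \<lfloor>e * real L\<rfloor>) < h"
    and A: "(\<lambda>L. (\<Sum>i=1..L. c L i) / real L) \<longlonglongrightarrow> A"
  shows "asymptotically_constant c A"
  unfolding asymptotically_constant_def
proof (intro allI impI)
  fix \<epsilon> :: real assume "0 < \<epsilon>"
  have "0 \<le> M" using bounds[of 2 1] by auto
  \<comment> \<open>\<open>e < \<epsilon>\<close> puts the levels in question between \<open>e * L\<close> and \<open>(1 - e) * L\<close>; the last bound makes
    the share \<open>2 * e * M\<close> of the boundary levels at most \<open>\<epsilon> / 4\<close>.\<close>
  define e where "e = min (\<epsilon> / 2) (min (1 / 4) (\<epsilon> / (8 * (M + 1))))"
  have "0 < e" using \<open>0 < \<epsilon>\<close> \<open>0 \<le> M\<close> by (simp add: e_def)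
  moreover have e_le: "e \<le> \<epsilon> / 2" "e \<le> 1 / 4" "e \<le> \<epsilon> / (8 * (M + 1))"
    unfolding e_def by linarith+
  ultimately have e: "0 < e" "e < \<epsilon>" "e < 1 / 2" by linarith+
  have eM: "e * (8 * (M + 1)) \<le> \<epsilon>"
    using e_le(3) \<open>0 \<le> M\<close> by (simp add: le_divide_eq)
  have "\<forall>\<^sub>F L in sequentially. \<bar>(\<Sum>i=1..L. c L i) / real L - A\<bar> < \<epsilon> / 4"
    using tendstoD[OF A, of "\<epsilon> / 4"] \<open>0 < \<epsilon>\<close> by (simp add: dist_real_def)
  moreover have "\<forall>\<^sub>F L in sequentially.
      c L (Suc (nat \<lfloor>e * real L\<rfloor>)) - c L (L - nat \<lfloor>e * real L\<rfloor>) < \<epsilon> / 4"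
    using osc[of e "\<epsilon> / 4"] e \<open>0 < \<epsilon>\<close> by auto
  ultimately show "\<forall>\<^sub>F L in sequentially. \<forall>i\<in>{1..L}.
      \<epsilon> * real L \<le> real i \<and> real i \<le> (1 - \<epsilon>) * real L \<longrightarrow> \<bar>c L i - A\<bar> < \<epsilon>"
    using eventually_ge_at_top[of 2]
  proof eventually_elim
    case (elim L)
    define m where "m = nat \<lfloor>e * real L\<rfloor>"
    have m: "real m \<le> e * real L" using e by (simp add: m_def)
    also have "e * real L < 1 / 2 * real L" using e elim by (intro mult_strict_right_mono) auto
    finally have "2 * m < L" by linarith
    show ?case
    proof (intro ballI impI)
      fix i assume i: "i \<in> {1..L}" "\<epsilon> * real L \<le> real i \<and> real i \<le> (1 - \<epsilon>) * real L"
      have "e * real L < \<epsilon> * real L" using e elim by (intro mult_strict_right_mono) auto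
      then have "real m < real i" "real m < real L - real i"
        using m i by (auto simp: algebra_simps)
      then have im: "Suc m \<le> i" "i \<le> L - m" by linarith+
      have mid: "\<bar>c L k - c L i\<bar> \<le> \<epsilon> / 4" if "k \<in> {Suc m..L - m}" for k
      proof -
        have "c L k \<le> c L (Suc m)" "c L (L - m) \<le> c L k" "c L i \<le> c L (Suc m)" "c L (L - m) \<le> c L i"
          using that im \<open>2 * m < L\<close> by (auto intro!: antimono)
        then show ?thesis using elim(2) unfolding m_def[symmetric] by linarith
      qed
      have all: "\<bar>c L k - c L i\<bar> \<le> M" if "k \<in> {1..L}" for k
        using that i bounds[of L k] bounds[of L i] elim by auto
      let ?f = "\<lambda>k. \<bar>c L k - c L i\<bar>"
      have split: "{1..L} = {1..m} \<union> {Suc m..L - m} \<union> {Suc (L - m)..L}"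
        using \<open>2 * m < L\<close> by auto
      have "sum ?f {1..L} = sum ?f {1..m} + sum ?f {Suc m..L - m} + sum ?f {Suc (L - m)..L}"
      proof -
        have "({1..m} \<union> {Suc m..L - m}) \<inter> {Suc (L - m)..L} = {}" "{1..m} \<inter> {Suc m..L - m} = {}"
          using \<open>2 * m < L\<close> by auto
        then show ?thesis unfolding split by (simp add: sum.union_disjoint)
      qed
      also have "\<dots> \<le> real m * M + real (L - m - m) * (\<epsilon> / 4) + real m * M"
      proof (intro add_mono)
        have "m \<le> L" using \<open>2 * m < L\<close> by simp
        show "sum ?f {1..m} \<le> real m * M"
          using sum_bounded_above[of "{1..m}" ?f M] all \<open>m \<le> L\<close> by simp
        show "sum ?f {Suc m..L - m} \<le> real (L - m - m) * (\<epsilon> / 4)"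
          using sum_bounded_above[of "{Suc m..L - m}" ?f "\<epsilon> / 4"] mid by simp
        show "sum ?f {Suc (L - m)..L} \<le> real m * M"
          using sum_bounded_above[of "{Suc (L - m)..L}" ?f M] all \<open>m \<le> L\<close> by simp
      qed
      also have "\<dots> \<le> e * real L * M + real L * (\<epsilon> / 4) + e * real L * M"
        using m \<open>0 \<le> M\<close> \<open>0 < \<epsilon>\<close> by (intro add_mono mult_right_mono) auto
      also have "\<dots> = real L * (2 * e * M + \<epsilon> / 4)" by (simp add: algebra_simps)
      also have "\<dots> \<le> real L * (\<epsilon> / 2)"
        using eM e by (intro mult_left_mono) (auto simp: algebra_simps)
      finally have "sum ?f {1..L} \<le> real L * (\<epsilon> / 2)" .
      have "\<bar>(\<Sum>k=1..L. c L k) / real L - c L i\<bar> = \<bar>\<Sum>k=1..L. c L k - c L i\<bar> / real L"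
      proof -
        have "(\<Sum>k=1..L. c L k) / real L - c L i = (\<Sum>k=1..L. c L k - c L i) / real L"
          using elim by (simp add: sum_subtractf diff_divide_distrib)
        then show ?thesis by (simp add: abs_divide)
      qed
      also have "\<dots> \<le> (real L * (\<epsilon> / 2)) / real L"
        by (intro divide_right_mono order_trans[OF sum_abs] \<open>sum ?f {1..L} \<le> real L * (\<epsilon> / 2)\<close>) simp
      also have "\<dots> = \<epsilon> / 2" using elim by simp
      finally show "\<bar>c L i - A\<bar> < \<epsilon>" using elim(1) \<open>0 < \<epsilon>\<close> by linarith
    qed
  qed
qed

text \<open>Every relative level \<open>t\<close> strictly between 0 and 1 is a limit of relative levels of interior
  costs, which tend to \<open>\<kappa>\<close>; so \<open>f t = \<kappa>\<close> by continuity. Continuity also carries this to the end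
  points of the unit interval, that is, to the first and the last cost.\<close>

lemma asymptotically_constant_profile:
  assumes "asymptotically_constant c \<kappa>" "cost_profile c f" "2 \<le> L" "i \<in> {1..L}"
  shows "c L i = \<kappa>"
proof -
  have f: "continuous_on {0..1} f"
    and c: "\<And>L i. 2 \<le> L \<Longrightarrow> i \<in> {1..L} \<Longrightarrow> c L i = f ((real i - 1) / (real L - 1))"
    using assms(2) by (auto simp: cost_profile_def)
  have inner: "f t = \<kappa>" if t: "t \<in> {0<..<1}" for t
  proof -
    \<comment> \<open>The profile counts relative levels as \<open>(k - 1) / (L - 1)\<close>, asymptotic constancy as \<open>k / L\<close>;
      both tend to \<open>t\<close> along \<open>k L\<close>.\<close>
    define k where "k = (\<lambda>L. Suc (nat \<lfloor>t * (real L - 1)\<rfloor>))"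
    define s where "s = (\<lambda>L. (real (k L) - 1) / (real L - 1))"
    have k: "real (k L) = 1 + real_of_int \<lfloor>t * (real L - 1)\<rfloor>" if "1 \<le> L" for L
      using that t by (simp add: k_def)
    have k_le: "k L \<in> {1..L}" if "1 \<le> L" for L
    proof -
      have "t * (real L - 1) \<le> real L - 1"
        using t that by (intro mult_left_le_one_le) auto
      then have "real (k L) \<le> real L" unfolding k[OF that] by linarith
      then show ?thesis by (simp add: k_def)
    qed
    have "(\<lambda>L::nat. real_of_int \<lfloor>t * (real L - 1)\<rfloor> / (real L - 1)) \<longlonglongrightarrow> t"
      using t by real_asymp
    moreover have "\<forall>\<^sub>F L in sequentially. real_of_int \<lfloor>t * (real L - 1)\<rfloor> / (real L - 1) = s L"
      using eventually_ge_at_top[of 1] by eventually_elim (simp add: s_def k)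
    ultimately have "s \<longlonglongrightarrow> t" by (rule Lim_transform_eventually)
    have "(\<lambda>L::nat. (1 + real_of_int \<lfloor>t * (real L - 1)\<rfloor>) / real L) \<longlonglongrightarrow> t"
      using t by real_asymp
    moreover have "\<forall>\<^sub>F L in sequentially.
        (1 + real_of_int \<lfloor>t * (real L - 1)\<rfloor>) / real L = real (k L) / real L"
      using eventually_ge_at_top[of 1] by eventually_elim (simp add: k)
    ultimately have kt: "(\<lambda>L. real (k L) / real L) \<longlonglongrightarrow> t" by (rule Lim_transform_eventually)
    have s: "\<forall>\<^sub>F L in sequentially. s L \<in> {0..1}"
      using eventually_ge_at_top[of 2]
    proof eventually_elim
      case (elim L)
      then show ?case using k_le[of L] by (auto simp: s_def divide_simps)
    qed
    have "(\<lambda>L. f (s L)) \<longlonglongrightarrow> f t"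
      by (rule continuous_on_tendsto_compose[OF f \<open>s \<longlonglongrightarrow> t\<close> _ s]) (use t in auto)
    moreover have "\<forall>\<^sub>F L in sequentially. f (s L) = c L (k L)"
      using eventually_ge_at_top[of 2] by eventually_elim (use c k_le in \<open>simp add: s_def\<close>)
    ultimately have "(\<lambda>L. c L (k L)) \<longlonglongrightarrow> f t" by (rule Lim_transform_eventually)
    moreover have "(\<lambda>L. c L (k L)) \<longlonglongrightarrow> \<kappa>"
    proof (rule tendstoI)
      fix \<epsilon> :: real assume "0 < \<epsilon>"
      define e where "e = min \<epsilon> (min (t / 2) ((1 - t) / 2))"
      have "0 < e" using \<open>0 < \<epsilon>\<close> t by (simp add: e_def)
      moreover have "e \<le> \<epsilon>" "e \<le> t / 2" "e \<le> (1 - t) / 2" unfolding e_def by linarith+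
      ultimately have e: "0 < e" "e \<le> \<epsilon>" "e < t" "t < 1 - e" using t by auto
      show "\<forall>\<^sub>F L in sequentially. dist (c L (k L)) \<kappa> < \<epsilon>"
        using assms(1)[unfolded asymptotically_constant_def, rule_format, OF e(1)]
          order_tendstoD(1)[OF kt e(3)] order_tendstoD(2)[OF kt e(4)] eventually_ge_at_top[of 1]
      proof eventually_elim
        case (elim L)
        then have "\<bar>c L (k L) - \<kappa>\<bar> < e"
          using k_le[of L] by (auto simp: divide_simps)
        then show ?case using e by (simp add: dist_real_def)
      qed
    qed
    ultimately show ?thesis by (rule LIMSEQ_unique)
  qed
  have "f u = \<kappa>" if "u \<in> {0..1}" for u
  proof (rule continuous_constant_on_closure[of "{0<..<1}" f])
    show "continuous_on (closure {0<..<1}) f" using f by simp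
  qed (use inner that in auto)
  moreover have "(real i - 1) / (real L - 1) \<in> {0..1}"
    using assms(3,4) by (auto simp: divide_simps)
  ultimately show ?thesis using c assms(3,4) by simp
qed


section \<open>Positivity of the scale factor\<close>

lemma integrable_square_if_cube:
  fixes X :: "'a \<Rightarrow> real"
  assumes "finite_measure M" "X \<in> borel_measurable M" "integrable M (\<lambda>x. X x ^ 3)"
  shows "integrable M (\<lambda>x. X x ^ 2)"
proof (rule Bochner_Integration.integrable_bound)
  interpret finite_measure M by fact
  show "integrable M (\<lambda>x. 1 + \<bar>X x ^ 3\<bar>)" using assms(3) by auto
  show "AE x in M. norm (X x ^ 2) \<le> norm (1 + \<bar>X x ^ 3\<bar>)"
  proof (rule AE_I2)
    fix x
    have "\<bar>X x\<bar> ^ 2 \<le> 1 + \<bar>X x\<bar> ^ 3"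
    proof (cases "\<bar>X x\<bar> \<le> 1")
      case True
      then have "\<bar>X x\<bar> ^ 2 \<le> 1" by (intro power_le_one) auto
      then show ?thesis by (simp add: add_increasing2)
    next
      case False
      then have "\<bar>X x\<bar> ^ 2 \<le> \<bar>X x\<bar> ^ 3" by (intro power_increasing) auto
      then show ?thesis by simp
    qed
    then show "norm (X x ^ 2) \<le> norm (1 + \<bar>X x ^ 3\<bar>)" by (simp add: power_abs)
  qed
qed (use assms in measurable)

lemma (in prob_space) expectation_square_le:
  fixes X :: "'a \<Rightarrow> real"
  assumes "integrable M X" "integrable M (\<lambda>x. X x ^ 2)"
  shows "(expectation X)\<^sup>2 \<le> expectation (\<lambda>x. X x ^ 2)"
  using variance_eq[OF assms] variance_positive[of X] by linarith

text \<open>Batches have at least one customer, so \<open>E \<varsigma> \<ge> 1\<close> and \<open>E \<varsigma>\<^sup>2 \<ge> E \<varsigma>\<close>. It remains to see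
  \<open>rho12 > 0\<close>: by \<open>expectation_square_le\<close> the scaled second moment is at least the square of
  \<open>load / E \<varsigma>\<close>, which tends to \<open>1 / (E \<varsigma>)\<^sup>2\<close>.\<close>

lemma theta_pos:
  assumes "lam > 0" "0 \<notin> set_pmf r" "integrable (measure_pmf r) real"
    and "upper_control lam r C B1" "condition_A lam r rho12 B1"
  shows "0 < theta r rho12"
proof -
  define m where "m = batch_moment r 1"
  have int2: "integrable (measure_pmf r) (\<lambda>i. real i ^ 2)"
    using assms(5) by (intro integrable_square_if_cube) (auto simp: condition_A_def intro: prob_space.finite_measure prob_space_measure_pmf)
  have pos: "1 \<le> real i" if "i \<in> set_pmf r" for i
    using that assms(2) by (cases i) auto
  have "measure_pmf.expectation r (\<lambda>_. 1) \<le> m"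
    unfolding m_def batch_moment_def using assms(3) pos
    by (intro integral_mono_AE) (auto simp: AE_measure_pmf_iff)
  then have "1 \<le> m" by simp
  have "m \<le> batch_moment r 2"
    unfolding m_def batch_moment_def using assms(3) int2 pos
    by (intro integral_mono_AE) (auto simp: AE_measure_pmf_iff self_le_power)
  obtain \<delta> where \<delta>: "\<delta> \<longlonglongrightarrow> 0" "\<And>L. 1 \<le> L \<Longrightarrow> load lam r (B1 L) = 1 + \<delta> L"
    using assms(4) by (auto simp: upper_control_def vanishing_deviation_def)
  have lower: "(\<lambda>L. ((1 + \<delta> L) / m)\<^sup>2) \<longlonglongrightarrow> ((1 + 0) / m)\<^sup>2"
    using \<open>1 \<le> m\<close> by (intro tendsto_intros \<delta>) auto
  have second: "(\<lambda>L. scaled_moment lam 2 (B1 L)) \<longlonglongrightarrow> rho12"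
    using assms(5) by (simp add: condition_A_def)
  have "\<forall>\<^sub>F L in sequentially. ((1 + \<delta> L) / m)\<^sup>2 \<le> scaled_moment lam 2 (B1 L)"
    using eventually_ge_at_top[of 1]
  proof eventually_elim
    case (elim L)
    then have B: "service_law (B1 L)" and cube: "integrable (B1 L) (\<lambda>x. x ^ 3)"
      using assms(4,5) by (auto simp: upper_control_def condition_A_def)
    interpret prob_space "B1 L" using B by (simp add: service_law_def)
    have sets [measurable_cong]: "sets (B1 L) = sets borel" using B by (simp add: service_law_def)
    have "integrable (B1 L) (\<lambda>x. x ^ 2)"
      using cube by (intro integrable_square_if_cube) (auto intro: finite_measure_axioms)
    then have "(expectation (\<lambda>x. x))\<^sup>2 \<le> expectation (\<lambda>x. x ^ 2)"
      using B by (intro expectation_square_le) (auto simp: service_law_def)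
    then have "lam\<^sup>2 * (expectation (\<lambda>x. x))\<^sup>2 \<le> lam\<^sup>2 * expectation (\<lambda>x. x ^ 2)"
      by (intro mult_left_mono) auto
    moreover have "(1 + \<delta> L) / m = lam * expectation (\<lambda>x. x)"
      using \<delta>(2)[OF elim] \<open>1 \<le> m\<close> unfolding load_def m_def[symmetric] by (simp add: field_simps)
    ultimately show ?case by (simp add: scaled_moment_def power_mult_distrib)
  qed
  then have "((1 + 0) / m)\<^sup>2 \<le> rho12"
    by (rule tendsto_le[OF sequentially_bot second lower])
  moreover have "0 < ((1 + 0) / m)\<^sup>2" using \<open>1 \<le> m\<close> by simp
  ultimately have "0 < rho12" by linarith
  then have "0 < rho12 * m ^ 3" using \<open>1 \<le> m\<close> by simp
  then show ?thesis
    using \<open>1 \<le> m\<close> \<open>m \<le> batch_moment r 2\<close> by (simp add: theta_def m_def)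
qed


section \<open>The optimality of the unit load\<close>

theorem corollary6p5:
  fixes lam j1 j2 rho12 :: real
    and r :: "nat pmf"
    and B2 :: "real measure"
    and Bup Blow :: "real \<Rightarrow> nat \<Rightarrow> real measure"
    and c :: "nat \<Rightarrow> nat \<Rightarrow> real"
    and Jup Jlow :: "real \<Rightarrow> real"
  defines "rho2 \<equiv> load lam r B2"
    and "\<theta> \<equiv> theta r rho12"
  assumes lam: "lam > 0"
    and batches: "0 \<notin> set_pmf r" "integrable (measure_pmf r) real"
    and B2: "service_law B2" "rho2 < 1"
    and costs: "cost_family c" "cost_limits_exist \<theta> c"
    and upper: "\<And>C. C \<ge> 0 \<Longrightarrow> upper_control lam r C (Bup C)"
    and lower: "\<And>C. C \<ge> 0 \<Longrightarrow> lower_control lam r C (Blow C)"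
    and A: "\<And>C. C \<ge> 0 \<Longrightarrow> condition_A lam r rho12 (Bup C)"
           "\<And>C. C \<ge> 0 \<Longrightarrow> condition_A lam r rho12 (Blow C)"
    and B: "\<And>C. C \<ge> 0 \<Longrightarrow> condition_B lam r (Blow C)"
    and limit_upper: "\<And>C. C \<ge> 0 \<Longrightarrow>
          (\<lambda>L. objective lam r (Bup C L) B2 j1 j2 c L) \<longlonglongrightarrow> Jup C"
    and limit_lower: "\<And>C. C \<ge> 0 \<Longrightarrow>
          (\<lambda>L. objective lam r (Blow C L) B2 j1 j2 c L) \<longlonglongrightarrow> Jlow C"
    and values_zero: "Jup 0 = J_zero \<theta> rho2 j1 j2 c" "Jlow 0 = J_zero \<theta> rho2 j1 j2 c"
    and values_upper: "\<And>C. C > 0 \<Longrightarrow> Jup C = J_upper \<theta> rho2 j1 j2 c C"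
    and optimal: "unit_load_optimal Jup Jlow"
  shows "j1 \<le> j2 * (rho2 / (1 - rho2)) \<and>
    (j1 = j2 * (rho2 / (1 - rho2)) \<longrightarrow>
      (\<exists>\<kappa>>0. asymptotically_constant c \<kappa> \<and>
        (\<forall>f. cost_profile c f \<longrightarrow> (\<forall>L\<ge>2. \<forall>i\<in>{1..L}. c L i = \<kappa>))))"
proof -
  define a where "a = j2 * (rho2 / (1 - rho2))"
  define \<kappa> where "\<kappa> = lim (\<lambda>L. (\<Sum>i=1..L. c L i) / real L)"
  define S where "S = (\<lambda>x. lim (\<lambda>L. cost_gf c L (1 - x / real L) / real L))"
  let ?m = "\<lambda>e L. nat \<lfloor>e * real L\<rfloor>"
  have \<theta>: "0 < \<theta>"
    unfolding \<theta>_def using theta_pos[OF lam batches upper[of 0] A(1)[of 0]] by simp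
  have antimono: "c L k \<le> c L i" if "1 \<le> i" "i \<le> k" "k \<le> L" for L i k
    using costs(1) that by (auto simp: cost_family_def)
  obtain c1 cl where c1: "\<And>L. 2 \<le> L \<Longrightarrow> c L 1 = c1" and cl: "0 < cl" "\<And>L. 2 \<le> L \<Longrightarrow> c L L = cl"
    using costs(1) by (auto simp: cost_family_def)
  have range: "cl \<le> c L i \<and> c L i \<le> c1" if "2 \<le> L" "1 \<le> i" "i \<le> L" for L i
    using antimono[of 1 i L] antimono[of i L L] c1 cl that by auto
  have avg: "(\<lambda>L. (\<Sum>i=1..L. c L i) / real L) \<longlonglongrightarrow> \<kappa>"
    using costs(2) by (simp add: cost_limits_exist_def convergent_LIMSEQ_iff \<kappa>_def)
  have disc: "(\<lambda>L. cost_gf c L (1 - x / real L) / real L) \<longlonglongrightarrow> S x" if "0 < x" for x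
  proof -
    have "convergent (\<lambda>L. cost_gf c L (1 - \<theta> * (x / \<theta>) / real L) / real L)"
      using costs(2) \<theta> that unfolding cost_limits_exist_def by (metis divide_pos_pos)
    then show ?thesis using \<theta> by (simp add: convergent_LIMSEQ_iff S_def)
  qed
  have opt: "(j1 + a) / \<theta> + \<kappa> \<le>
      x / \<theta> * ((j1 + a * exp x) / (exp x - 1)) + x * exp x / (exp x - 1) * S x" if "0 < x" for x
  proof -
    have "Jup 0 \<le> Jup (x / \<theta>)"
      using optimal divide_pos_pos[OF that \<theta>] less_imp_le
      unfolding unit_load_optimal_def is_arg_min_def by (meson not_less)
    moreover have "Jup 0 = (j1 + a) / \<theta> + \<kappa>"
      by (simp add: values_zero(1) J_zero_def a_def \<kappa>_def add_divide_distrib)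
    moreover have "Jup (x / \<theta>) =
        x / \<theta> * ((j1 + a * exp x) / (exp x - 1)) + x * exp x / (exp x - 1) * S x"
      using that \<theta> by (simp add: values_upper J_upper_def a_def S_def add_divide_distrib)
    ultimately show ?thesis by simp
  qed
  \<comment> \<open>\<open>h = 0\<close> yields the inequality between \<open>j1\<close> and \<open>a\<close>, and \<open>h > 0\<close> the case of equality.\<close>
  have first_order: "2 * \<theta> * (e\<^sup>2 * (1 - 2 * e) * (h / 4)) \<le> a - j1"
    if "0 < e" "e < 1 / 2" "0 \<le> h"
      "\<exists>\<^sub>F L in sequentially. h \<le> c L (Suc (?m e L)) - c L (L - ?m e L)" for e h
    using \<theta> _ opt
  proof (rule optimality_first_order)
    fix x :: real assume "0 < x" "x \<le> 1 / 2"
    then show "S x + e\<^sup>2 * (1 - 2 * e) * (h / 4) * x \<le> \<kappa> * ((1 - exp (- x)) / x)"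
      using discounted_cost_limit_gap[OF antimono that(1-3) \<open>0 < x\<close> _ that(4) avg disc[OF \<open>0 < x\<close>]]
      by (simp only: times_divide_eq_left mult.assoc)
  qed
  have "j1 \<le> a"
  proof -
    have "\<forall>\<^sub>F L in sequentially. 0 \<le> c L (Suc (?m (1/4) L)) - c L (L - ?m (1/4) L)"
      using eventually_ge_at_top[of 2]
    proof eventually_elim
      case (elim L)
      have "real (?m (1/4) L) \<le> 1 / 4 * real L" by linarith
      then have "Suc (?m (1/4) L) \<le> L - ?m (1/4) L" using elim by linarith
      then show ?case using antimono[of "Suc (?m (1/4) L)" "L - ?m (1/4) L" L] by simp
    qed
    then have "\<exists>\<^sub>F L in sequentially. 0 \<le> c L (Suc (?m (1/4) L)) - c L (L - ?m (1/4) L)"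
      by (rule eventually_frequently[OF sequentially_bot])
    from first_order[OF _ _ _ this] show ?thesis by simp
  qed
  moreover have "\<exists>\<kappa>>0. asymptotically_constant c \<kappa> \<and>
      (\<forall>f. cost_profile c f \<longrightarrow> (\<forall>L\<ge>2. \<forall>i\<in>{1..L}. c L i = \<kappa>))" if "j1 = a"
  proof (intro exI conjI)
    have "cl \<le> \<kappa>"
    proof (rule tendsto_lowerbound[OF avg])
      show "\<forall>\<^sub>F L in sequentially. cl \<le> (\<Sum>i=1..L. c L i) / real L"
        using eventually_ge_at_top[of 2]
      proof eventually_elim
        case (elim L)
        then have "real L * cl \<le> (\<Sum>i=1..L. c L i)"
          using sum_bounded_below[of "{1..L}" cl "c L"] range by simp
        then show ?case using elim by (simp add: field_simps)
      qed
    qed simp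
    then show "0 < \<kappa>" using cl(1) by simp
    show const: "asymptotically_constant c \<kappa>"
    proof (rule asymptotically_constantI[OF antimono _ _ avg])
      show "0 \<le> c L i \<and> c L i \<le> c1" if "2 \<le> L" "1 \<le> i" "i \<le> L" for L i
        using range[OF that] cl(1) by simp
      show "\<forall>\<^sub>F L in sequentially. c L (Suc (?m e L)) - c L (L - ?m e L) < h"
        if "0 < e" "e < 1 / 2" "0 < h" for e h
      proof (rule ccontr)
        assume "\<not> ?thesis"
        then have "\<exists>\<^sub>F L in sequentially. h \<le> c L (Suc (?m e L)) - c L (L - ?m e L)"
          by (simp add: not_eventually not_less)
        then have "2 * \<theta> * (e\<^sup>2 * (1 - 2 * e) * (h / 4)) \<le> 0"
          using first_order[of e h] that \<open>j1 = a\<close> by simp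
        moreover have "0 < 2 * \<theta> * (e\<^sup>2 * (1 - 2 * e) * (h / 4))"
          using \<theta> that by (intro mult_pos_pos) auto
        ultimately show False by simp
      qed
    qed
    show "\<forall>f. cost_profile c f \<longrightarrow> (\<forall>L\<ge>2. \<forall>i\<in>{1..L}. c L i = \<kappa>)"
      using asymptotically_constant_profile[OF const] by blast
  qed
  ultimately show ?thesis unfolding a_def by blast
qed

end
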